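(* Let $X$ be a (real) inner product space and let $U:\mathcal P(\Sigma_{\mathsf G}^{\mathbb N})\to X$ be continuous with respect to the weak topology. Fix a continuous function $\varphi:\Sigma_{\mathsf G}^{\mathbb N}\to\mathbb R$ with $\varphi<0$, and for $q\in X$ let $\tau(q)=\sigma_{\mathrm{ab}}\big(\zeta_q^{\mathrm{co},U}(\varphi;\cdot)\big)$. Let $C\subseteq X$ be a subset of $X$ and let $f(C)$ be the unique real number such that $$\limsup_{r\searrow0}\sigma_{\mathrm{rad}}\big(\zeta_{B(C,r)}^{\mathrm{dyn},U}(f(C)\,\varphi;\cdot)\big)=1.$$ Then $$f(C)\le\sup_{\alpha\in\overline C}\tau^*(\alpha).$$
   Context: Symbolic setting. $\mathsf G=(\mathsf V,\mathsf E)$ is a finite strongly connected directed multigraph with vertex set $\mathsf V$ and (nonempty) edge set $\mathsf E$; $\operatorname{i}(e)$ and $\operatorname{t}(e)$ denote the initial and terminal vertex of $e\in\mathsf E$. $\Sigma_{\mathsf G}^n$ is the set of strings $e_1\ldots e_n$ of edges with $\operatorname{t}(e_k)=\operatorname{i}(e_{k+1})$ for $1\le k<n$; $\Sigma_{\mathsf G}^{\mathbb N}$ is the set of infinite strings $e_1e_2\ldots$ with $\operatorname{t}(e_k)=\operatorname{i}(e_{k+1})$ for all $k$, with the product topology. For $\mathbf i\in\Sigma_{\mathsf G}^n$, $[\mathbf i]$ is the cylinder of all $\mathbf j\in\Sigma_{\mathsf G}^{\mathbb N}$ whose first $n$ letters form $\mathbf i$. $S$ is the shift map. $\mathcal P(\Sigma_{\mathsf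 G}^{\mathbb N})$ is the set of Borel probability measures on $\Sigma_{\mathsf G}^{\mathbb N}$ with the weak topology. $L_n\mathbf u=\frac1n\sum_{k=0}^{n-1}\delta_{S^k\mathbf u}$ and $UL_n[\mathbf i]=\{U(L_n\mathbf u):\mathbf u\in[\mathbf i]\}$. Fine zeta-function. For $C\subseteq X$ and continuous $\varphi$, $$\zeta_C^{\mathrm{dyn},U}(\varphi;z)=\sum_n\frac{z^n}{n}\Bigg(\sum_{\mathbf i\in\Sigma_{\mathsf G}^n,\;UL_n[\mathbf i]\subseteq C}\ \sup_{\mathbf u\in[\mathbf i]}\exp\sum_{k=0}^{n-1}\varphi(S^k\mathbf u)\Bigg),\qquad z\in\mathbb C,$$ and $\sigma_{\mathrm{rad}}$ denotes the radius of convergence of a power series. $B(C,r)=\{x\in X:\operatorname{dist}(x,C)\le r\}$ and $\overline C$ is the closure of $C$. Coarse zeta-function. With $\langle\cdot|\cdot\rangle$ the inner product of $X$ and $q\in X$, $$\zeta_q^{\mathrm{co},U}(\varphi;s)=\sum_n\sum_{\mathbf i\in\Sigma_{\mathsf G}^n}\exp\Bigg(\Big(\sup_{\mathbf u\in[\mathbf i]}\langle q|UL_n\mathbf u\rangle+s\Big)\sup_{\mathbf u\in[\mathbf i]}\sum_{k=0}^{n-1}\varphi(S^k\mathbf u)\Bigg),\qquad s\in\mathbb C,$$ and $\sigma_{\mathrm{ab}}$ denotes the abscissa of convergence, i.e. the infimum of all $t\in\mathbb R$ such that the series converges for all $s$ with $\operatorname{Re}s>t$. Legendre transform. For $g:X\to\mathbb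 R$, $g^*(x)=\inf_{y\in X}(\langle x|y\rangle+g(y))\in[-\infty,\infty]$. *)

theory Defs
  imports "HOL-Probability.Probability" "Graph_Theory.Digraph_Component"
begin

section \<open>Symbolic dynamics of a directed multigraph\<close>

text \<open>An edge \<open>e\<close> of \<open>G\<close> runs from \<open>tail G e\<close> to \<open>head G e\<close>.
  Strings are written with 0-based indices.\<close>

definition strings :: "('v, 'e) pre_digraph \<Rightarrow> nat \<Rightarrow> 'e list set" where
  "strings G n = {w. length w = n \<and> set w \<subseteq> arcs G \<and>
     (\<forall>k. Suc k < n \<longrightarrow> head G (w ! k) = tail G (w ! Suc k))}"

definition inf_strings :: "('v, 'e) pre_digraph \<Rightarrow> (nat \<Rightarrow> 'e) set" where
  "inf_strings G = {u. \<forall>k. u k \<in> arcs G \<and> head G (u k) = tail G (u (Suc k))}"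

definition shift_topology :: "('v, 'e) pre_digraph \<Rightarrow> (nat \<Rightarrow> 'e) topology" where
  "shift_topology G =
     subtopology (product_topology (\<lambda>_. discrete_topology (arcs G)) UNIV) (inf_strings G)"

definition cylinder :: "('v, 'e) pre_digraph \<Rightarrow> 'e list \<Rightarrow> (nat \<Rightarrow> 'e) set" where
  "cylinder G w = {u \<in> inf_strings G. \<forall>k<length w. u k = w ! k}"

definition shift :: "(nat \<Rightarrow> 'e) \<Rightarrow> nat \<Rightarrow> 'e" where
  "shift u = (\<lambda>k. u (Suc k))"

definition birkhoff_sum :: "((nat \<Rightarrow> 'e) \<Rightarrow> real) \<Rightarrow> nat \<Rightarrow> (nat \<Rightarrow> 'e) \<Rightarrow> real" where
  "birkhoff_sum \<phi> n u = (\<Sum>k<n. \<phi> ((shift ^^ k) u))"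


section \<open>Borel probability measures with the weak topology\<close>

definition borel_of :: "'a topology \<Rightarrow> 'a measure" where
  "borel_of T = sigma (topspace T) {W. openin T W}"

definition borel_probs :: "'a topology \<Rightarrow> 'a measure set" where
  "borel_probs T = {M. sets M = sets (borel_of T) \<and> prob_space M}"

text \<open>The coarsest topology on the Borel probability measures for which integration
  against every bounded continuous real function is continuous.\<close>

definition weak_topology :: "'a topology \<Rightarrow> 'a measure topology" where
  "weak_topology T = topology_generated_by
     {{M \<in> borel_probs T. integral\<^sup>L M f \<in> W} | f W.
        continuous_map T euclideanreal f \<and> bounded (f ` topspace T) \<and> open W}"

text \<open>The average of the point masses at the first \<open>n\<close> points of the orbit of \<open>u\<close>;
  meaningful for \<open>n > 0\<close> and \<open>u \<in> inf_strings G\<close>.\<close>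

definition empirical :: "('v, 'e) pre_digraph \<Rightarrow> nat \<Rightarrow> (nat \<Rightarrow> 'e) \<Rightarrow> (nat \<Rightarrow> 'e) measure" where
  "empirical G n u =
     (let B = borel_of (shift_topology G) in
      measure_of (space B) (sets B)
        (\<lambda>A. (\<Sum>k<n. emeasure (return B ((shift ^^ k) u)) A) / of_nat n))"


section \<open>The two zeta-functions\<close>

text \<open>The condition \<open>C \<noteq> {}\<close> is needed because \<open>infdist x {} = 0\<close> in the library,
  whereas the distance to the empty set is infinite.\<close>

definition nbhd :: "'x::metric_space set \<Rightarrow> real \<Rightarrow> 'x set" where
  "nbhd C r = {x. C \<noteq> {} \<and> infdist x C \<le> r}"

definition fine_zeta ::
  "('v, 'e) pre_digraph \<Rightarrow> ((nat \<Rightarrow> 'e) measure \<Rightarrow> 'x) \<Rightarrow> 'x set \<Rightarrow>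
   ((nat \<Rightarrow> 'e) \<Rightarrow> real) \<Rightarrow> complex fps" where
  "fine_zeta G U C \<phi> = Abs_fps (\<lambda>n. if n = 0 then 0 else
     of_real ((\<Sum>w | w \<in> strings G n \<and> (\<lambda>u. U (empirical G n u)) ` cylinder G w \<subseteq> C.
                 SUP u\<in>cylinder G w. exp (birkhoff_sum \<phi> n u)) / real n))"

definition coarse_term ::
  "('v, 'e) pre_digraph \<Rightarrow> ((nat \<Rightarrow> 'e) measure \<Rightarrow> 'x::real_inner) \<Rightarrow>
   ((nat \<Rightarrow> 'e) \<Rightarrow> real) \<Rightarrow> 'x \<Rightarrow> complex \<Rightarrow> nat \<Rightarrow> complex" where
  "coarse_term G U \<phi> q s n =
     (\<Sum>w\<in>strings G n.
        exp ((of_real (SUP u\<in>cylinder G w. inner q (U (empirical G n u))) + s)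
             * of_real (SUP u\<in>cylinder G w. birkhoff_sum \<phi> n u)))"

definition conv_abscissa :: "(complex \<Rightarrow> nat \<Rightarrow> complex) \<Rightarrow> ereal" where
  "conv_abscissa F = Inf (ereal ` {t. \<forall>s. Re s > t \<longrightarrow> summable (F s)})"

text \<open>Both zeta-functions sum over \<open>n \<ge> 1\<close>, hence \<open>Suc n\<close>.\<close>

definition tau ::
  "('v, 'e) pre_digraph \<Rightarrow> ((nat \<Rightarrow> 'e) measure \<Rightarrow> 'x::real_inner) \<Rightarrow>
   ((nat \<Rightarrow> 'e) \<Rightarrow> real) \<Rightarrow> 'x \<Rightarrow> ereal" where
  "tau G U \<phi> q = conv_abscissa (\<lambda>s n. coarse_term G U \<phi> q s (Suc n))"

text \<open>The function \<open>g\<close> is allowed extended real values so that \<open>tau\<close> can be used without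
  first proving that it is finite; as the inner product is finite, no term is of the
  form \<open>\<infinity> - \<infinity>\<close>.\<close>

definition legendre :: "('x::real_inner \<Rightarrow> ereal) \<Rightarrow> 'x \<Rightarrow> ereal" where
  "legendre g x = (INF y. ereal (inner x y) + g y)"

end

(* Suppose sup tau^* < t < t' < fC on the closure of C. The image K of U is compact, so its part in
   the closure of C, and hence also in a small neighbourhood of C, is covered by finitely many
   half-spaces {x. <x|q> + s < t} with s > tau q. For long strings w the values of U on the empirical
   measures of [w] hardly vary, so <q|U L_n u> + s <= t' on [w] for one of these pairs (q, s). As the
   Birkhoff sums are at most -n m with m > 0, the weight exp(fC S_n phi) of w is at most
   exp(-n delta) times the corresponding term of the coarse zeta-function at s, and these terms are
   bounded because that series converges. So the fine zeta-functions have a common radius of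
   convergence above 1. Compactness of K and the small oscillation of U on cylinders come from weak
   sequential compactness, obtained from Helly's theorem by embedding the shift space into the line. *)

theory Submission
  imports Defs
begin

section \<open>Weak convergence on compact spaces that embed into the line\<close>

lemma space_borel_of [simp]: "space (borel_of T) = topspace T"
  by (simp add: borel_of_def space_measure_of_conv)

lemma openin_sets_borel_of: "openin T W \<Longrightarrow> W \<in> sets (borel_of T)"
  unfolding borel_of_def
  by (subst sets_measure_of) (auto dest: openin_subset intro: sigma_sets.Basic)

lemma continuous_map_borel_measurable:
  fixes f :: "'a \<Rightarrow> 'b::topological_space"
  assumes "continuous_map T euclidean f"
  shows "f \<in> borel_measurable (borel_of T)"
proof (rule borel_measurableI)
  fix S :: "'b set" assume "open S"
  then have "openin T {x \<in> topspace T. f x \<in> S}"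
    using assms by (simp add: continuous_map)
  moreover have "{x \<in> topspace T. f x \<in> S} = f -` S \<inter> space (borel_of T)" by auto
  ultimately show "f -` S \<inter> space (borel_of T) \<in> sets (borel_of T)"
    by (metis openin_sets_borel_of)
qed

lemma borel_probsD:
  assumes "M \<in> borel_probs T"
  shows "prob_space M" "sets M = sets (borel_of T)" "space M = topspace T"
  using assms sets_eq_imp_space_eq[of M "borel_of T"] by (auto simp: borel_probs_def)

text \<open>Eventual membership survives finite intersections and enlarging the set, so induction
  over the generated topology reduces the claim to the generating sets, where it is convergence of a
  single integral.\<close>

lemma limitin_weak_topology:
  assumes Ms: "\<And>n. Ms n \<in> borel_probs T" and M: "M \<in> borel_probs T"
    and conv: "\<And>f. continuous_map T euclideanreal f \<Longrightarrow> bounded (f ` topspace T) \<Longrightarrow>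
                  ((\<lambda>n. integral\<^sup>L (Ms n) f) \<longlongrightarrow> integral\<^sup>L M f) F"
  shows "limitin (weak_topology T) Ms M F"
proof -
  let ?S = "{{M \<in> borel_probs T. integral\<^sup>L M f \<in> W} | f W.
        continuous_map T euclideanreal f \<and> bounded (f ` topspace T) \<and> open W}"
  have "eventually (\<lambda>n. Ms n \<in> V) F" if "generate_topology_on ?S V" "M \<in> V" for V
    using that
  proof (induction V rule: generate_topology_on.induct)
    case (Basis V)
    then obtain f W where V: "V = {M \<in> borel_probs T. integral\<^sup>L M f \<in> W}"
      and f: "continuous_map T euclideanreal f" "bounded (f ` topspace T)" and W: "open W"
      by auto
    have "eventually (\<lambda>n. integral\<^sup>L (Ms n) f \<in> W) F"
      using topological_tendstoD[OF conv[OF f] W] Basis V by auto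
    then show ?case using Ms V by simp
  next
    case (UN K)
    then obtain k where "k \<in> K" "M \<in> k" by auto
    with UN have "eventually (\<lambda>n. Ms n \<in> k) F" by blast
    then show ?case by eventually_elim (use \<open>k \<in> K\<close> in auto)
  qed (auto simp: eventually_conj_iff)
  \<comment> \<open>A limit must lie in the topspace, which for a generated topology is the union of
    the generating sets. The zero function exhibits \<open>borel_probs T\<close> as one of
    them.\<close>
  moreover have "{M \<in> borel_probs T. integral\<^sup>L M (\<lambda>_. 0) \<in> (UNIV::real set)} \<in> ?S"
    by (rule CollectI, rule exI[of _ "\<lambda>_. 0"], rule exI[of _ UNIV])
       (auto simp: bounded_iff)
  then have "M \<in> \<Union>?S" using M by auto
  ultimately show ?thesis
    by (auto simp: limitin_def weak_topology_def openin_topology_generated_by_iff)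
qed

text \<open>Compactness makes \<open>h\<close> a homeomorphism onto a compact subset of the line.
  Measures on \<open>T\<close> can thus be carried to the line, where Helly's theorem is
  available.\<close>

locale real_embedded_compact =
  fixes T :: "'a topology" and h :: "'a \<Rightarrow> real"
  assumes compact: "compact_space T"
    and cont: "continuous_map T euclideanreal h"
    and inj: "inj_on h (topspace T)"
begin

lemma compact_image_embedding: "closedin T S \<Longrightarrow> compact (h ` S)"
  using image_compactin[OF closedin_compact_space[OF compact] cont] by simp

text \<open>On the compact image, \<open>f\<close> composed with the inverse of \<open>h\<close> is
  continuous and bounded, and Tietze's theorem extends it to the line with the same bound. Integrals
  over \<open>T\<close> thus become integrals of bounded continuous functions on the line.\<close>

lemma factor:
  assumes f: "continuous_map T euclideanreal f"
  obtains F B where "continuous_on UNIV F" "\<And>x. \<bar>F x\<bar> \<le> B" "\<And>u. u \<in> topspace T \<Longrightarrow> f u = F (h u)"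
proof -
  let ?H = "h ` topspace T"
  have H: "compact ?H" by (simp add: compact_image_embedding)
  have "continuous_map T (top_of_set ?H) h"
    using cont by (simp add: continuous_map_in_subtopology)
  then have "homeomorphic_map T (top_of_set ?H) h"
    by (intro continuous_imp_homeomorphic_map)
       (auto simp: compact inj Hausdorff_space_subtopology)
  then obtain g where g: "homeomorphic_maps T (top_of_set ?H) h g"
    by (auto simp: homeomorphic_map_maps)
  then have "continuous_map (top_of_set ?H) euclideanreal (f \<circ> g)"
    by (intro continuous_map_compose[OF _ f]) (simp add: homeomorphic_maps_def)
  then have fg: "continuous_on ?H (f \<circ> g)" by simp
  then obtain B where B: "B \<ge> 0" "\<And>x. x \<in> ?H \<Longrightarrow> norm ((f \<circ> g) x) \<le> B"
    using compact_imp_bounded[OF compact_continuous_image[OF fg H]]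
    by (metis bounded_pos imageI less_eq_real_def)
  obtain F where F: "continuous_on UNIV F" "\<And>x. x \<in> ?H \<Longrightarrow> F x = (f \<circ> g) x"
     "\<And>x. x \<in> UNIV \<Longrightarrow> norm (F x) \<le> B"
    using Tietze[OF fg _ B, of UNIV] compact_imp_closed[OF H] by auto
  show thesis
  proof (rule that[of F B])
    show "f u = F (h u)" if "u \<in> topspace T" for u
      using that F(2) g by (simp add: homeomorphic_maps_def)
  qed (use F in auto)
qed

lemma bounded_continuous:
  assumes "continuous_map T euclideanreal f"
  obtains B where "B > 0" "\<And>u. u \<in> topspace T \<Longrightarrow> \<bar>f u\<bar> \<le> B"
proof -
  obtain F B where F: "continuous_on UNIV F" "\<And>x. \<bar>F x\<bar> \<le> B"
    "\<And>u. u \<in> topspace T \<Longrightarrow> f u = F (h u)"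
    using factor[OF assms] by blast
  show thesis
  proof (rule that[of "B + 1"])
    show "0 < B + 1" using F(2)[of 0] by linarith
    show "\<bar>f u\<bar> \<le> B + 1" if "u \<in> topspace T" for u
      using F(2)[of "h u"] F(3)[OF that] by simp
  qed
qed

text \<open>Serves to carry a limit measure back from the line. The image of an open set is a
  difference of two compact sets, hence Borel; \<open>z\<close> is a filler value off the
  image.\<close>

lemma inverse_measurable:
  assumes z: "z \<in> topspace T"
  shows "(\<lambda>x. if x \<in> h ` topspace T then inv_into (topspace T) h x else z)
          \<in> borel \<rightarrow>\<^sub>M borel_of T" (is "?g \<in> _")
  unfolding borel_of_def
proof (rule measurable_measure_of)
  show "{W. openin T W} \<subseteq> Pow (topspace T)" by (auto dest: openin_subset)
  show "?g \<in> space borel \<rightarrow> topspace T" using z by (auto intro!: inv_into_into)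
  fix W assume "W \<in> {W. openin T W}"
  then have W: "openin T W" "W \<subseteq> topspace T" by (auto dest: openin_subset)
  have meas: "h ` S \<in> sets borel" if "closedin T S" for S
    using compact_image_embedding[OF that] by (simp add: borel_compact)
  have "h ` W = h ` topspace T - h ` (topspace T - W)"
    using inj W(2) by (subst inj_on_image_set_diff[OF inj]) (auto simp: inj_on_def)
  also have "\<dots> \<in> sets borel"
    using W by (intro sets.Diff meas) (auto intro: closedin_diff)
  finally have hW: "h ` W \<in> sets borel" .
  have "?g -` W = (if z \<in> W then h ` W \<union> - h ` topspace T else h ` W)"
    using W(2) by (auto split: if_splits simp: inv_into_f_f[OF inj] subset_iff)
  also have "\<dots> \<in> sets borel"
    using hW meas[of "topspace T"] by (auto intro: sets.Un)
  finally show "?g -` W \<inter> space borel \<in> sets borel" by simp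
qed

text \<open>The image measures on the line are tight, so a subsequence converges weakly. Its limit
  lives on the compact image of \<open>h\<close> and is pulled back by the measurable
  inverse.\<close>

theorem weak_sequential_compactness:
  assumes Ms: "\<And>n::nat. Ms n \<in> borel_probs T"
  obtains r M where "strict_mono (r :: nat \<Rightarrow> nat)" "M \<in> borel_probs T"
    "\<forall>f. continuous_map T euclideanreal f \<longrightarrow> (\<lambda>n. integral\<^sup>L (Ms (r n)) f) \<longlonglongrightarrow> integral\<^sup>L M f"
proof -
  let ?H = "h ` topspace T"
  have meas: "h \<in> borel_measurable (Ms n)" for n
    using continuous_map_borel_measurable[OF cont] borel_probsD[OF Ms[of n]]
    by (metis measurable_cong_sets)
  define \<mu> where "\<mu> n = distr (Ms n) borel h" for n
  have rd: "real_distribution (\<mu> n)" for n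
    unfolding \<mu>_def using borel_probsD(1)[OF Ms] meas by (intro prob_space.real_distribution_distr)
  have H: "compact ?H" by (simp add: compact_image_embedding)
  obtain b where b: "b > 0" "\<And>x. x \<in> ?H \<Longrightarrow> \<bar>x\<bar> \<le> b"
    using compact_imp_bounded[OF H] by (auto simp: bounded_pos)
  \<comment> \<open>Tightness is stated with half-open intervals; the left end \<open>-b-1\<close>
    keeps the point \<open>-b\<close> inside.\<close>
  have mass: "measure (\<mu> n) {-b-1<..b} = 1" for n
  proof -
    interpret prob_space "Ms n" using Ms borel_probsD by blast
    have "h -` {-b-1<..b} \<inter> space (Ms n) = space (Ms n)"
      using b borel_probsD(3)[OF Ms[of n]] by (auto simp: abs_le_iff) (smt (verit) imageI)+
    then show ?thesis using meas by (simp add: \<mu>_def measure_distr prob_space)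
  qed
  have "tight \<mu>"
    unfolding tight_def
  proof (intro conjI allI impI rd)
    show "\<exists>a b. a < b \<and> (\<forall>n. measure (\<mu> n) {a<..b} > 1 - \<epsilon>)" if "\<epsilon> > 0" for \<epsilon> :: real
      using mass b(1) that by (intro exI[of _ "-b-1"] exI[of _ b]) simp
  qed
  from tight_imp_convergent_subsubsequence[OF this strict_mono_id]
  obtain r \<nu> where r: "strict_mono r" and \<nu>: "real_distribution \<nu>" and wc: "weak_conv_m (\<mu> \<circ> r) \<nu>"
    by auto
  interpret \<nu>: real_distribution \<nu> by fact
  have ic: "(\<lambda>n. integral\<^sup>L (Ms (r n)) (F \<circ> h)) \<longlonglongrightarrow> integral\<^sup>L \<nu> F"
    if F: "continuous_on UNIV F" "\<And>x. \<bar>F x\<bar> \<le> B" for F :: "real \<Rightarrow> real" and B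
  proof -
    have "(\<lambda>n. integral\<^sup>L ((\<mu> \<circ> r) n) F) \<longlonglongrightarrow> integral\<^sup>L \<nu> F"
      by (rule weak_conv_imp_integral_bdd_continuous_conv[OF _ \<nu> wc, of F B])
         (use F rd in \<open>auto simp: continuous_on_eq_continuous_at\<close>)
    moreover have "F \<in> borel_measurable borel" using F(1) by (rule borel_measurable_continuous_onI)
    ultimately show ?thesis
      using meas by (simp add: \<mu>_def integral_distr o_def)
  qed
  have nonempty: "?H \<noteq> {}"
  proof -
    interpret prob_space "Ms 0" using Ms borel_probsD by blast
    show ?thesis using not_empty borel_probsD(3)[OF Ms[of 0]] by auto
  qed
  then obtain z where z: "z \<in> topspace T" by blast
  have AE: "AE x in \<nu>. x \<in> ?H"
  proof -
    \<comment> \<open>The truncated distance to the image is bounded, continuous and zero on the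
      image, so its integral vanishes along the sequence and in the limit.\<close>
    let ?F = "\<lambda>x. min 1 (infdist x ?H)"
    have F: "continuous_on UNIV ?F" by (intro continuous_intros)
    have Fb: "\<bar>?F x\<bar> \<le> 1" for x using infdist_nonneg[of x ?H] by (simp add: abs_le_iff)
    have "integral\<^sup>L (Ms (r n)) (?F \<circ> h) = 0" for n
      by (subst Bochner_Integration.integral_cong[where g="\<lambda>_. 0"])
         (auto simp: borel_probsD(3)[OF Ms])
    then have "(\<lambda>n. integral\<^sup>L (Ms (r n)) (?F \<circ> h)) \<longlonglongrightarrow> 0" by simp
    then have "integral\<^sup>L \<nu> ?F = 0" using ic[OF F Fb] LIMSEQ_unique by blast
    moreover have "integrable \<nu> ?F"
      using Fb borel_measurable_continuous_onI[OF F]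
      by (intro \<nu>.integrable_const_bound[where B=1]) auto
    ultimately have "AE x in \<nu>. ?F x = 0"
      using integral_nonneg_eq_0_iff_AE[of \<nu> ?F] by (auto simp: infdist_nonneg)
    then show ?thesis
    proof (rule AE_mp, intro AE_I2 impI)
      fix x assume "?F x = 0"
      then have "infdist x ?H = 0" by (simp add: min_def split: if_splits)
      then show "x \<in> ?H"
        using in_closed_iff_infdist_zero[OF compact_imp_closed[OF H] nonempty] by blast
    qed
  qed
  let ?g = "\<lambda>x. if x \<in> ?H then inv_into (topspace T) h x else z"
  have g: "?g \<in> \<nu> \<rightarrow>\<^sub>M borel_of T"
    using inverse_measurable[OF z] \<nu>.events_eq_borel by (metis measurable_cong_sets)
  let ?M = "distr \<nu> (borel_of T) ?g"
  show thesis
  proof (rule that[OF r])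
    show "?M \<in> borel_probs T"
      using \<nu>.prob_space_distr[OF g] by (simp add: borel_probs_def)
  next
    show "\<forall>f. continuous_map T euclideanreal f \<longrightarrow>
            (\<lambda>n. integral\<^sup>L (Ms (r n)) f) \<longlonglongrightarrow> integral\<^sup>L ?M f"
    proof (intro allI impI)
      fix f assume f: "continuous_map T euclideanreal f"
      obtain F B where F: "continuous_on UNIV F" "\<And>x. \<bar>F x\<bar> \<le> B" "\<And>u. u \<in> topspace T \<Longrightarrow> f u = F (h u)"
        using factor[OF f] by blast
      have "integral\<^sup>L (Ms (r n)) f = integral\<^sup>L (Ms (r n)) (F \<circ> h)" for n
        by (rule Bochner_Integration.integral_cong) (auto simp: borel_probsD(3)[OF Ms] F)
      moreover have "integral\<^sup>L ?M f = integral\<^sup>L \<nu> (f \<circ> ?g)"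
        using g continuous_map_borel_measurable[OF f] by (simp add: integral_distr o_def)
      moreover have "integral\<^sup>L \<nu> (f \<circ> ?g) = integral\<^sup>L \<nu> F"
      proof (rule integral_cong_AE)
        show "f \<circ> ?g \<in> borel_measurable \<nu>"
          using g continuous_map_borel_measurable[OF f] by (rule measurable_comp)
        show "F \<in> borel_measurable \<nu>"
          using borel_measurable_continuous_onI[OF F(1)] by simp
        show "AE x in \<nu>. (f \<circ> ?g) x = F x"
          using AE by (rule AE_mp) (auto intro!: AE_I2 simp: inv_into_into f_inv_into_f F(3))
      qed
      ultimately show "(\<lambda>n. integral\<^sup>L (Ms (r n)) f) \<longlonglongrightarrow> integral\<^sup>L ?M f"
        using ic[OF F(1,2)] by simp
    qed
  qed
qed

text \<open>The subsequence and the limit are fixed before \<open>Ns\<close> is given, so that one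
  limit serves the subsequence itself and every other sequence whose integrals approach those of the
  subsequence.\<close>

lemma weak_continuous_subsequence:
  assumes Ms: "\<And>n::nat. Ms n \<in> borel_probs T"
    and U: "continuous_map (weak_topology T) euclidean U"
  obtains r M where "strict_mono (r :: nat \<Rightarrow> nat)" "M \<in> borel_probs T"
    "\<forall>Ns. (\<forall>n. Ns n \<in> borel_probs T) \<longrightarrow>
       (\<forall>f. continuous_map T euclideanreal f \<longrightarrow>
          (\<lambda>n. integral\<^sup>L (Ns n) f - integral\<^sup>L (Ms (r n)) f) \<longlonglongrightarrow> 0) \<longrightarrow>
       (\<lambda>n. U (Ns n)) \<longlonglongrightarrow> U M"
proof -
  obtain r M where r: "strict_mono r" and M: "M \<in> borel_probs T"
    and lim: "\<forall>f. continuous_map T euclideanreal f \<longrightarrow>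
                (\<lambda>n. integral\<^sup>L (Ms (r n)) f) \<longlonglongrightarrow> integral\<^sup>L M f"
    by (rule weak_sequential_compactness[OF Ms])
  show thesis
  proof (rule that[OF r M], intro allI impI)
    fix Ns assume Ns: "\<forall>n. Ns n \<in> borel_probs T"
      and d: "\<forall>f. continuous_map T euclideanreal f \<longrightarrow>
          (\<lambda>n. integral\<^sup>L (Ns n) f - integral\<^sup>L (Ms (r n)) f) \<longlonglongrightarrow> 0"
    have "(\<lambda>n. integral\<^sup>L (Ns n) f) \<longlonglongrightarrow> integral\<^sup>L M f" if "continuous_map T euclideanreal f" for f
      using tendsto_add[OF d[rule_format, OF that] lim[rule_format, OF that]] by simp
    then have "limitin (weak_topology T) Ns M sequentially"
      using Ns M by (intro limitin_weak_topology) auto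
    from continuous_map_limit[OF U this] show "(\<lambda>n. U (Ns n)) \<longlonglongrightarrow> U M"
      by (simp add: o_def)
  qed
qed

lemma compact_weak_continuous_image:
  fixes U :: "'a measure \<Rightarrow> 'x::metric_space"
  assumes U: "continuous_map (weak_topology T) euclidean U"
  shows "compact (U ` borel_probs T)"
  unfolding compact_eq_seq_compact_metric seq_compact_def
proof (intro allI impI)
  fix x :: "nat \<Rightarrow> 'x" assume "\<forall>n. x n \<in> U ` borel_probs T"
  then have "\<forall>n. \<exists>M. M \<in> borel_probs T \<and> x n = U M" by auto
  then obtain Ms where Ms: "\<And>n. Ms n \<in> borel_probs T" "\<And>n. x n = U (Ms n)"
    by metis
  obtain r M where r: "strict_mono (r :: nat \<Rightarrow> nat)" and M: "M \<in> borel_probs T"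
    and lim: "\<forall>Ns. (\<forall>n. Ns n \<in> borel_probs T) \<longrightarrow>
       (\<forall>f. continuous_map T euclideanreal f \<longrightarrow>
          (\<lambda>n. integral\<^sup>L (Ns n) f - integral\<^sup>L (Ms (r n)) f) \<longlonglongrightarrow> 0) \<longrightarrow>
       (\<lambda>n. U (Ns n)) \<longlonglongrightarrow> U M"
    by (rule weak_continuous_subsequence[OF Ms(1) U])
  \<comment> \<open>Here \<open>Ns\<close> is the subsequence itself, so the differences of
    integrals are zero.\<close>
  have "(\<lambda>n. U (Ms (r n))) \<longlonglongrightarrow> U M"
    using lim[rule_format, of "\<lambda>n. Ms (r n)"] Ms(1) by simp
  with r M show "\<exists>l\<in>U ` borel_probs T. \<exists>r. strict_mono r \<and> (x \<circ> r) \<longlonglongrightarrow> l"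
    using Ms(2) by (auto simp: o_def)
qed

end

section \<open>The shift space\<close>

lemma topspace_shift_topology [simp]: "topspace (shift_topology G) = inf_strings G"
  by (auto simp: shift_topology_def inf_strings_def PiE_def)

lemma inf_strings_shift: "u \<in> inf_strings G \<Longrightarrow> (shift ^^ k) u \<in> inf_strings G"
  by (induction k) (auto simp: inf_strings_def shift_def)

lemma funpow_shift_apply [simp]: "(shift ^^ k) u j = u (k + j)"
  by (induction k arbitrary: j) (auto simp: shift_def)

lemma finite_strings: "finite (arcs G) \<Longrightarrow> finite (strings G n)"
  by (rule finite_subset[OF _ finite_lists_length_eq[of "arcs G" n]]) (auto simp: strings_def)

lemma continuous_map_coordinate:
  "continuous_map (shift_topology G) euclideanreal (\<lambda>u. f (u k))"
proof -
  have "continuous_map (product_topology (\<lambda>_. discrete_topology (arcs G)) UNIV)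
          (discrete_topology (arcs G)) (\<lambda>u. u k)"
    by (rule continuous_map_product_projection) simp
  then have "continuous_map (product_topology (\<lambda>_. discrete_topology (arcs G)) UNIV)
          euclideanreal (f \<circ> (\<lambda>u. u k))"
    by (rule continuous_map_compose) simp
  then show ?thesis
    unfolding shift_topology_def o_def by (rule continuous_map_from_subtopology)
qed

lemma compact_shift_topology:
  assumes "finite (arcs G)"
  shows "compact_space (shift_topology G)"
proof -
  let ?P = "product_topology (\<lambda>_::nat. discrete_topology (arcs G)) UNIV"
  have P: "compact_space ?P"
    using assms by (simp add: compact_space_product_topology compact_space_discrete_topology)
  have tP: "topspace ?P = {u. \<forall>k. u k \<in> arcs G}" by (auto simp: PiE_def)
  \<comment> \<open>\<open>?A k (e, e')\<close> prescribes the letters at \<open>k\<close> and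
    \<open>Suc k\<close> and is closed. The union over the finitely many composable pairs in
    \<open>?E\<close> says that the transition at \<open>k\<close> is admissible.\<close>
  let ?A = "\<lambda>k (e, e'). {u \<in> topspace ?P. u k \<in> {e}} \<inter> {u \<in> topspace ?P. u (Suc k) \<in> {e'}}"
  let ?E = "{(e, e'). e \<in> arcs G \<and> e' \<in> arcs G \<and> head G e = tail G e'}"
  have fin: "finite ?E"
    by (rule finite_subset[of _ "arcs G \<times> arcs G"]) (use assms in auto)
  have "closedin ?P {u \<in> topspace ?P. u k \<in> {e}}" if "e \<in> arcs G" for k e
    by (rule closedin_continuous_map_preimage[OF continuous_map_product_projection])
       (use that in auto)
  then have "closedin ?P (\<Union>p\<in>?E. ?A k p)" for k
    using fin by (intro closedin_Union) (auto intro!: closedin_Int)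
  then have "closedin ?P (\<Inter>k. \<Union>p\<in>?E. ?A k p)" by (intro closedin_Inter) auto
  moreover have "(\<Inter>k. \<Union>p\<in>?E. ?A k p) = inf_strings G"
    unfolding tP inf_strings_def by (auto; fast)
  ultimately have "compactin ?P (inf_strings G)"
    using closedin_compact_space[OF P] by simp
  then show ?thesis
    unfolding shift_topology_def by (rule compact_space_subtopology)
qed

text \<open>The embedding is the expansion in base \<open>2 * N + 2\<close> with digits below \<open>N\<close>: the tail after
  the first differing digit is too small to compensate for it.\<close>

lemma digit_expansion:
  fixes c :: "nat \<Rightarrow> nat" and N :: nat
  assumes "\<And>k. c k < N"
  defines "\<beta> \<equiv> 1 / (2 * real N + 2)"
  shows "summable (\<lambda>k. real (c k) * \<beta> ^ k)"
    and "(\<Sum>k. real (c k) * \<beta> ^ k) = (\<Sum>k<m. real (c k) * \<beta> ^ k) + \<beta> ^ m * (\<Sum>k. real (c (k + m)) * \<beta> ^ k)"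
    and "0 \<le> (\<Sum>k. real (c k) * \<beta> ^ k)" "(\<Sum>k. real (c k) * \<beta> ^ k) \<le> 2 * real N"
proof -
  have \<beta>: "0 < \<beta>" "\<beta> \<le> 1/2" by (auto simp: \<beta>_def field_simps)
  have summ: "summable (\<lambda>k. real (c k) * \<beta> ^ k)" if "\<And>k. c k < N" for c :: "nat \<Rightarrow> nat"
  proof (rule summable_comparison_test')
    show "summable (\<lambda>k. real N * \<beta> ^ k)" using \<beta> by (intro summable_mult summable_geometric) auto
    show "norm (real (c k) * \<beta> ^ k) \<le> real N * \<beta> ^ k" if "k \<ge> 0" for k
      using \<beta> \<open>\<And>k. c k < N\<close>[of k] by (auto simp: abs_mult intro!: mult_right_mono)
  qed
  show s: "summable (\<lambda>k. real (c k) * \<beta> ^ k)" using summ assms by blast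
  show "(\<Sum>k. real (c k) * \<beta> ^ k) = (\<Sum>k<m. real (c k) * \<beta> ^ k) + \<beta> ^ m * (\<Sum>k. real (c (k + m)) * \<beta> ^ k)"
    using summ[of "\<lambda>k. c (k + m)"] assms(1)
    by (subst suminf_split_initial_segment[OF s, of m], subst suminf_mult[symmetric])
       (auto simp: power_add mult_ac)
  show "0 \<le> (\<Sum>k. real (c k) * \<beta> ^ k)"
    using s \<beta> by (intro suminf_nonneg) auto
  have "(\<Sum>k. real (c k) * \<beta> ^ k) \<le> (\<Sum>k. real N * (1/2) ^ k)"
    using \<beta> assms(1)
    by (intro suminf_le s mult_mono power_mono summable_mult summable_geometric)
       (auto intro: less_imp_le)
  also have "\<dots> = 2 * real N"
    using suminf_mult[OF summable_geometric[of "1/2::real"], of "real N"] suminf_geometric[of "1/2::real"]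
    by simp
  finally show "(\<Sum>k. real (c k) * \<beta> ^ k) \<le> 2 * real N" .
qed

text \<open>The edges are numbered and serve as digits. The second conclusion is recorded because it
  turns uniform continuity on the line into a modulus of continuity in terms of common
  prefixes.\<close>

lemma shift_space_embedding:
  fixes G :: "('v, 'e) pre_digraph"
  assumes fin: "finite (arcs G)"
  obtains h where "real_embedded_compact (shift_topology G) h"
    "\<forall>\<epsilon>>0. \<exists>m. \<forall>u\<in>inf_strings G. \<forall>v\<in>inf_strings G.
        (\<forall>k<m. u k = v k) \<longrightarrow> \<bar>h u - h v\<bar> < \<epsilon>"
proof -
  obtain c :: "'e \<Rightarrow> nat" and N where c: "c ` arcs G = {i. i < N}" "inj_on c (arcs G)"
    using finite_imp_inj_to_nat_seg[OF fin] by blast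
  define \<beta> where "\<beta> = 1 / (2 * real N + 2)"
  define h where "h u = (\<Sum>k. real (c (u k)) * \<beta> ^ k)" for u
  have \<beta>: "0 < \<beta>" "\<beta> < 1" "\<beta> * (2 * real N) < 1" by (auto simp: \<beta>_def field_simps)
  have cN: "c (u k) < N" if "u \<in> inf_strings G" for u k
    using that c(1) by (auto simp: inf_strings_def)
  note D = digit_expansion[of _ N, folded \<beta>_def]
  have split: "h u = (\<Sum>k<m. real (c (u k)) * \<beta> ^ k) + \<beta> ^ m * h (\<lambda>k. u (k + m))"
    if "u \<in> inf_strings G" for u m
    using D(2)[of "\<lambda>k. c (u k)" m] cN[OF that] by (simp add: h_def)
  have sh: "(\<lambda>k. u (k + m)) \<in> inf_strings G" if "u \<in> inf_strings G" for u m
    using that by (auto simp: inf_strings_def)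
  have h: "0 \<le> h u" "h u \<le> 2 * real N" if "u \<in> inf_strings G" for u
    using D(3,4)[of "\<lambda>k. c (u k)"] cN[OF that] by (simp_all add: h_def)
  have tail: "\<bar>h u - (\<Sum>k<m. real (c (u k)) * \<beta> ^ k)\<bar> \<le> \<beta> ^ m * (2 * real N)"
    if "u \<in> inf_strings G" for u m
    using split[OF that, of m] h[OF sh[OF that, of m]] \<beta>
    by (simp add: abs_mult mult_left_mono)
  have small: "\<exists>m. \<beta> ^ m * (4 * real N) < \<epsilon>" if "\<epsilon> > 0" for \<epsilon>
  proof -
    have "(\<lambda>m. \<beta> ^ m * (4 * real N)) \<longlonglongrightarrow> 0 * (4 * real N)"
      using \<beta> by (intro tendsto_mult LIMSEQ_realpow_zero tendsto_const) auto
    from order_tendstoD(2)[OF this, of \<epsilon>] that show ?thesis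
      by (auto simp: eventually_sequentially)
  qed
  \<comment> \<open>The common initial sums cancel, and each of the two tails is at most
    \<open>\<beta> ^ m * (2 * real N)\<close>.\<close>
  have close: "\<bar>h u - h v\<bar> \<le> \<beta> ^ m * (4 * real N)"
    if "u \<in> inf_strings G" "v \<in> inf_strings G" "\<forall>k<m. u k = v k" for u v m
    using tail[OF that(1), of m] tail[OF that(2), of m] that(3) by (simp add: abs_le_iff)
  show thesis
  proof (rule that[of h])
    show "\<forall>\<epsilon>>0. \<exists>m. \<forall>u\<in>inf_strings G. \<forall>v\<in>inf_strings G.
            (\<forall>k<m. u k = v k) \<longrightarrow> \<bar>h u - h v\<bar> < \<epsilon>"
      using small close by (meson le_less_trans)
    show "real_embedded_compact (shift_topology G) h"
    proof
      show "compact_space (shift_topology G)" by (rule compact_shift_topology[OF fin])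
      \<comment> \<open>The partial sums depend on finitely many coordinates and converge to
        \<open>h\<close> uniformly, by the bound \<open>tail\<close>.\<close>
      have "continuous_map (shift_topology G) Met_TC.mtopology h"
      proof (rule Met_TC.continuous_map_uniform_limit[where F = sequentially
            and f = "\<lambda>m u. \<Sum>k<m. real (c (u k)) * \<beta> ^ k"])
        show "\<forall>\<^sub>F m in sequentially. continuous_map (shift_topology G) Met_TC.mtopology
                 (\<lambda>u. \<Sum>k<m. real (c (u k)) * \<beta> ^ k)"
          by (intro always_eventually allI)
             (auto simp: mtopology_is_euclidean intro!: continuous_map_sum
               continuous_map_coordinate[where f = "\<lambda>e. real (c e) * _"])
        show "\<forall>\<^sub>F m in sequentially. \<forall>u\<in>topspace (shift_topology G).
                h u \<in> UNIV \<and> dist (\<Sum>k<m. real (c (u k)) * \<beta> ^ k) (h u) < \<epsilon>"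
          if \<epsilon>: "0 < \<epsilon>" for \<epsilon>
        proof -
          have "(\<lambda>m. \<beta> ^ m * (2 * real N)) \<longlonglongrightarrow> 0 * (2 * real N)"
            using \<beta> by (intro tendsto_mult LIMSEQ_realpow_zero tendsto_const) auto
          then have "\<forall>\<^sub>F m in sequentially. \<beta> ^ m * (2 * real N) < \<epsilon>"
            using \<epsilon> by (auto dest: order_tendstoD(2))
          then show ?thesis
            by eventually_elim
               (use tail in \<open>auto simp: dist_real_def abs_minus_commute intro: le_less_trans\<close>)
        qed
      qed simp
      then show "continuous_map (shift_topology G) euclideanreal h"
        by (simp add: mtopology_is_euclidean)
      show "inj_on h (topspace (shift_topology G))"
      proof (rule inj_onI, rule ccontr)
        fix u v assume uv: "u \<in> topspace (shift_topology G)" "v \<in> topspace (shift_topology G)"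
          and eq: "h u = h v" and "u \<noteq> v"
        then have u: "u \<in> inf_strings G" and v: "v \<in> inf_strings G" by auto
        define m where "m = (LEAST k. u k \<noteq> v k)"
        from \<open>u \<noteq> v\<close> have ex: "\<exists>k. u k \<noteq> v k" by auto
        then have m: "u m \<noteq> v m" unfolding m_def by (rule LeastI_ex)
        have before: "u k = v k" if "k < m" for k
          using that not_less_Least[of k "\<lambda>k. u k \<noteq> v k"] by (auto simp: m_def)
        let ?a = "h (\<lambda>k. u (k + Suc m))" and ?b = "h (\<lambda>k. v (k + Suc m))"
        \<comment> \<open>Both expansions are cut just after the first differing digit, at
          \<open>Suc m\<close>; the earlier digits cancel.\<close>
        have "\<beta> ^ m * (real (c (u m)) + \<beta> * ?a) = \<beta> ^ m * (real (c (v m)) + \<beta> * ?b)"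
          using eq split[OF u, of "Suc m"] split[OF v, of "Suc m"] before
          by (simp add: algebra_simps)
        then have "real (c (u m)) + \<beta> * ?a = real (c (v m)) + \<beta> * ?b"
          using \<beta>(1) by (simp only: mult_cancel_left power_eq_0_iff) auto
        then have e: "real (c (u m)) - real (c (v m)) = \<beta> * (?b - ?a)"
          by (simp add: algebra_simps)
        have "\<bar>?b - ?a\<bar> \<le> 2 * real N"
          using h[OF sh[OF u, of "Suc m"]] h[OF sh[OF v, of "Suc m"]] by (simp add: abs_le_iff)
        then have "\<bar>\<beta> * (?b - ?a)\<bar> \<le> \<beta> * (2 * real N)"
          using \<beta>(1) by (simp only: abs_mult) (simp add: mult_left_mono)
        then have "\<bar>real (c (u m)) - real (c (v m))\<bar> < 1" using e \<beta>(3) by linarith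
        \<comment> \<open>Natural numbers at distance less than one are equal.\<close>
        then have "c (u m) = c (v m)" by linarith
        then show False
          using c(2) m u v by (auto simp: inf_strings_def inj_on_def)
      qed
    qed
  qed
qed

section \<open>Continuous functions and Birkhoff sums on common prefixes\<close>

lemma modulus_of_continuity:
  assumes fin: "finite (arcs G)"
    and f: "continuous_map (shift_topology G) euclideanreal f" and "\<epsilon> > 0"
  obtains m where "\<And>u v. u \<in> inf_strings G \<Longrightarrow> v \<in> inf_strings G \<Longrightarrow> (\<forall>k<m. u k = v k)
                     \<Longrightarrow> \<bar>f u - f v\<bar> < \<epsilon>"
proof -
  obtain h where h: "real_embedded_compact (shift_topology G) h"
    and close: "\<forall>\<epsilon>>0. \<exists>m. \<forall>u\<in>inf_strings G. \<forall>v\<in>inf_strings G.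
        (\<forall>k<m. u k = v k) \<longrightarrow> \<bar>h u - h v\<bar> < \<epsilon>"
    by (rule shift_space_embedding[OF fin])
  interpret real_embedded_compact "shift_topology G" h by fact
  obtain F B where F: "continuous_on UNIV F" "\<And>x. \<bar>F x\<bar> \<le> B"
      "\<And>u. u \<in> topspace (shift_topology G) \<Longrightarrow> f u = F (h u)"
    by (rule factor[OF f]) (rule that, simp_all)
  let ?H = "h ` inf_strings G"
  have H: "compact ?H" using compact_image_embedding[OF closedin_topspace] by simp
  \<comment> \<open>A long common prefix brings the codes under \<open>h\<close> close together, and
    uniform continuity of \<open>F\<close> on the compact set of codes then brings the values of
    \<open>f\<close> together.\<close>
  have "uniformly_continuous_on ?H F"
    using continuous_on_subset[OF F(1)] H by (intro compact_uniformly_continuous) auto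
  then obtain d where d: "d > 0" "\<And>x y. x \<in> ?H \<Longrightarrow> y \<in> ?H \<Longrightarrow> dist y x < d \<Longrightarrow> dist (F y) (F x) < \<epsilon>"
    using \<open>\<epsilon> > 0\<close> unfolding uniformly_continuous_on_def by metis
  obtain m where m: "\<forall>u\<in>inf_strings G. \<forall>v\<in>inf_strings G. (\<forall>k<m. u k = v k) \<longrightarrow> \<bar>h u - h v\<bar> < d"
    using close d(1) by blast
  show thesis
    by (rule that[of m]) (use m d(2) F(3) in \<open>auto simp: dist_real_def\<close>)
qed

text \<open>After \<open>k\<close> shifts the strings still share \<open>n - k\<close> letters, so
  all but at most \<open>m\<close> summands differ by less than \<open>\<epsilon> / 2\<close>. The
  exceptional ones cost \<open>2 * B\<close> each, which for large \<open>n\<close> is absorbed by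
  the other half of \<open>\<epsilon>\<close>.\<close>

lemma birkhoff_distortion:
  assumes fin: "finite (arcs G)"
    and f: "continuous_map (shift_topology G) euclideanreal f" and "\<epsilon> > 0"
  shows "\<forall>\<^sub>F n in sequentially. \<forall>u\<in>inf_strings G. \<forall>v\<in>inf_strings G. (\<forall>k<n. u k = v k) \<longrightarrow>
           \<bar>birkhoff_sum f n u - birkhoff_sum f n v\<bar> \<le> real n * \<epsilon>"
proof -
  obtain h where h: "real_embedded_compact (shift_topology G) h"
    by (rule shift_space_embedding[OF fin]) (rule that)
  interpret real_embedded_compact "shift_topology G" h by fact
  obtain B where "B > 0" "\<And>u. u \<in> topspace (shift_topology G) \<Longrightarrow> \<bar>f u\<bar> \<le> B"
    by (rule bounded_continuous[OF f]) (rule that, simp_all)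
  then have B: "B > 0" "\<And>u. u \<in> inf_strings G \<Longrightarrow> \<bar>f u\<bar> \<le> B" by auto
  obtain m where m: "\<And>u v. u \<in> inf_strings G \<Longrightarrow> v \<in> inf_strings G \<Longrightarrow> (\<forall>k<m. u k = v k)
                     \<Longrightarrow> \<bar>f u - f v\<bar> < \<epsilon> / 2"
    using modulus_of_continuity[OF fin f, of "\<epsilon> / 2"] \<open>\<epsilon> > 0\<close> by auto
  have "\<bar>birkhoff_sum f n u - birkhoff_sum f n v\<bar> \<le> real n * \<epsilon>"
    if n: "real n \<ge> 4 * B * real m / \<epsilon>" and uv: "u \<in> inf_strings G" "v \<in> inf_strings G" "\<forall>k<n. u k = v k"
    for n u v
  proof -
    let ?d = "\<lambda>k. \<bar>f ((shift ^^ k) u) - f ((shift ^^ k) v)\<bar>"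
    have "\<bar>birkhoff_sum f n u - birkhoff_sum f n v\<bar> \<le> (\<Sum>k<n. ?d k)"
      by (simp add: birkhoff_sum_def flip: sum_subtractf)
    also have "\<dots> \<le> (\<Sum>k<n. \<epsilon> / 2 + (if n < k + m then 2 * B else 0))"
    proof (rule sum_mono)
      fix k assume "k \<in> {..<n}"
      have s: "(shift ^^ k) u \<in> inf_strings G" "(shift ^^ k) v \<in> inf_strings G"
        using uv inf_strings_shift by blast+
      show "?d k \<le> \<epsilon> / 2 + (if n < k + m then 2 * B else 0)"
      proof (cases "n < k + m")
        case True
        then show ?thesis using B(2)[OF s(1)] B(2)[OF s(2)] \<open>\<epsilon> > 0\<close> by (auto simp: abs_le_iff)
      next
        case False
        then have "?d k < \<epsilon> / 2" using uv(3) by (intro m s) auto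
        with False show ?thesis by simp
      qed
    qed
    also have "\<dots> = real n * (\<epsilon> / 2) + 2 * B * real (card {k \<in> {..<n}. n < k + m})"
      by (simp add: sum.distrib sum.If_cases Int_def)
    also have "\<dots> \<le> real n * (\<epsilon> / 2) + 2 * B * real m"
    proof -
      have "{k \<in> {..<n}. n < k + m} \<subseteq> {n - m..<n}" by auto
      then have "card {k \<in> {..<n}. n < k + m} \<le> card {n - m..<n}" by (intro card_mono) auto
      then have "card {k \<in> {..<n}. n < k + m} \<le> m" by simp
      then show ?thesis using B(1) by simp
    qed
    also have "\<dots> \<le> real n * \<epsilon>"
      using n \<open>\<epsilon> > 0\<close> by (simp add: field_simps)
    finally show ?thesis .
  qed
  moreover have "\<forall>\<^sub>F n in sequentially. real n \<ge> 4 * B * real m / \<epsilon>"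
    by (rule eventually_sequentiallyI[of "nat \<lceil>4 * B * real m / \<epsilon>\<rceil>"]) linarith
  ultimately show ?thesis by (auto elim: eventually_mono)
qed

section \<open>Empirical measures and the oscillation of \<open>U\<close> on cylinders\<close>

lemma empirical_eq_distr:
  assumes n: "n > 0" and u: "u \<in> inf_strings G"
  shows "empirical G n u =
    distr (measure_pmf (pmf_of_set {..<n})) (borel_of (shift_topology G)) (\<lambda>k. (shift ^^ k) u)"
    (is "_ = ?D")
proof -
  let ?B = "borel_of (shift_topology G)"
  have meas: "(\<lambda>k. (shift ^^ k) u) \<in> measure_pmf (pmf_of_set {..<n}) \<rightarrow>\<^sub>M ?B"
    using inf_strings_shift[OF u] by (auto simp: measurable_def)
  have "(\<Sum>k<n. emeasure (return ?B ((shift ^^ k) u)) A) / of_nat n = emeasure ?D A"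
    if "A \<in> sets ?B" for A
  proof -
    have "emeasure ?D A = (\<integral>\<^sup>+ x. indicator A x \<partial>?D)"
      using that by simp
    also have "\<dots> = (\<integral>\<^sup>+ k. indicator A ((shift ^^ k) u) \<partial>measure_pmf (pmf_of_set {..<n}))"
      using meas that by (intro nn_integral_distr) auto
    also have "\<dots> = (\<Sum>k<n. indicator A ((shift ^^ k) u)) / of_nat n"
      using n by (subst nn_integral_pmf_of_set) (auto simp: lessThan_empty_iff)
    finally show ?thesis using that by simp
  qed
  \<comment> \<open>\<open>measure_of\<close> depends only on the values on measurable sets, so the
    defining formula may be replaced by that of the genuine measure \<open>?D\<close>, which brings
    countable additivity with it.\<close>
  then have "empirical G n u = measure_of (space ?B) (sets ?B) (emeasure ?D)"
    unfolding empirical_def Let_def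
    by (intro measure_of_eq[OF sets.space_closed]) (simp only: sets.sigma_sets_eq)
  also have "\<dots> = ?D" using measure_of_of_measure[of ?D] by simp
  finally show ?thesis .
qed

lemma empirical_borel_probs:
  assumes n: "n > 0" and u: "u \<in> inf_strings G"
  shows "empirical G n u \<in> borel_probs (shift_topology G)"
proof -
  have "(\<lambda>k. (shift ^^ k) u) \<in> measure_pmf (pmf_of_set {..<n}) \<rightarrow>\<^sub>M borel_of (shift_topology G)"
    using inf_strings_shift[OF u] by (auto simp: measurable_def)
  then show ?thesis
    by (simp add: borel_probs_def empirical_eq_distr[OF assms] measure_pmf.prob_space_distr)
qed

lemma integral_empirical:
  assumes n: "n > 0" and u: "u \<in> inf_strings G"
    and f: "continuous_map (shift_topology G) euclideanreal f"
  shows "integral\<^sup>L (empirical G n u) f = birkhoff_sum f n u / real n"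
proof -
  have "(\<lambda>k. (shift ^^ k) u) \<in> measure_pmf (pmf_of_set {..<n}) \<rightarrow>\<^sub>M borel_of (shift_topology G)"
    using inf_strings_shift[OF u] by (auto simp: measurable_def)
  then have "integral\<^sup>L (empirical G n u) f =
      integral\<^sup>L (measure_pmf (pmf_of_set {..<n})) (\<lambda>k. f ((shift ^^ k) u))"
    using continuous_map_borel_measurable[OF f] by (simp add: empirical_eq_distr[OF n u] integral_distr)
  also have "\<dots> = birkhoff_sum f n u / real n"
    using n by (subst integral_pmf_of_set) (auto simp: birkhoff_sum_def lessThan_empty_iff)
  finally show ?thesis .
qed

text \<open>Otherwise there are arbitrarily long prefixes with two extensions whose values stay
  \<open>\<epsilon>\<close> apart. By \<open>birkhoff_distortion\<close> the integrals against the
  two empirical measures approach each other, so along a subsequence both values tend to the same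
  point.\<close>

lemma cylinder_oscillation:
  fixes U :: "(nat \<Rightarrow> 'e) measure \<Rightarrow> 'x::metric_space"
  assumes fin: "finite (arcs G)"
    and U: "continuous_map (weak_topology (shift_topology G)) euclidean U" and "\<epsilon> > 0"
  shows "\<forall>\<^sub>F n in sequentially. \<forall>u\<in>inf_strings G. \<forall>v\<in>inf_strings G. (\<forall>k<n. u k = v k) \<longrightarrow>
           dist (U (empirical G n u)) (U (empirical G n v)) < \<epsilon>"
proof (rule ccontr)
  let ?T = "shift_topology G"
  assume "\<not> ?thesis"
  then have "\<exists>\<^sub>F n in sequentially. \<exists>u\<in>inf_strings G. \<exists>v\<in>inf_strings G.
      (\<forall>k<n. u k = v k) \<and> \<epsilon> \<le> dist (U (empirical G n u)) (U (empirical G n v))"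
    unfolding not_eventually by (rule frequently_elim1) (meson not_less)
  then have "\<forall>N. \<exists>n u v. n > N \<and> u \<in> inf_strings G \<and> v \<in> inf_strings G \<and> (\<forall>k<n. u k = v k) \<and>
      \<epsilon> \<le> dist (U (empirical G n u)) (U (empirical G n v))"
    unfolding frequently_sequentially by (metis Suc_le_eq)
  then obtain n u v where n: "\<And>N. n N > N" and u: "\<And>N. u N \<in> inf_strings G"
    and v: "\<And>N. v N \<in> inf_strings G" and uv: "\<And>N. \<forall>k<n N. u N k = v N k"
    and far: "\<And>N. \<epsilon> \<le> dist (U (empirical G (n N) (u N))) (U (empirical G (n N) (v N)))"
    by metis
  have n0: "n N > 0" for N using n[of N] by simp
  obtain h where h: "real_embedded_compact ?T h"
    by (rule shift_space_embedding[OF fin]) (rule that)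
  interpret real_embedded_compact ?T h by fact
  let ?M = "\<lambda>N. empirical G (n N) (u N)" and ?M' = "\<lambda>N. empirical G (n N) (v N)"
  have M: "?M N \<in> borel_probs ?T" and M': "?M' N \<in> borel_probs ?T" for N
    using empirical_borel_probs[OF n0] u v by blast+
  obtain r L where r: "strict_mono (r :: nat \<Rightarrow> nat)" and
    lim: "\<forall>Ns. (\<forall>n. Ns n \<in> borel_probs ?T) \<longrightarrow>
       (\<forall>f. continuous_map ?T euclideanreal f \<longrightarrow>
          (\<lambda>n. integral\<^sup>L (Ns n) f - integral\<^sup>L (?M (r n)) f) \<longlonglongrightarrow> 0) \<longrightarrow>
       (\<lambda>n. U (Ns n)) \<longlonglongrightarrow> U L"
    by (rule weak_continuous_subsequence[of ?M, OF M U])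
  have "(\<lambda>j. U (?M (r j))) \<longlonglongrightarrow> U L" by (intro lim[rule_format] M) simp
  moreover have "(\<lambda>j. U (?M' (r j))) \<longlonglongrightarrow> U L"
  proof (intro lim[rule_format] M')
    fix f assume f: "continuous_map ?T euclideanreal f"
    \<comment> \<open>\<open>n N > N\<close> makes the prefix lengths tend to infinity, as the
      eventual distortion bound requires.\<close>
    have top: "filterlim (\<lambda>j. n (r j)) at_top sequentially"
      by (rule filterlim_at_top_mono[OF filterlim_subseq[OF r]])
         (auto intro!: always_eventually less_imp_le n)
    show "(\<lambda>j. integral\<^sup>L (?M' (r j)) f - integral\<^sup>L (?M (r j)) f) \<longlonglongrightarrow> 0"
    proof (rule tendstoI)
      fix e :: real assume "e > 0"
      \<comment> \<open>The distortion bound is not strict; halving \<open>e\<close> yields the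
        strict inequality.\<close>
      then have "e / 2 > 0" by simp
      from eventually_compose_filterlim[OF birkhoff_distortion[OF fin f this] top]
      show "\<forall>\<^sub>F j in sequentially. dist (integral\<^sup>L (?M' (r j)) f - integral\<^sup>L (?M (r j)) f) 0 < e"
      proof eventually_elim
        case (elim j)
        let ?n = "n (r j)"
        have "\<bar>birkhoff_sum f ?n (v (r j)) - birkhoff_sum f ?n (u (r j))\<bar> \<le> real ?n * (e / 2)"
          using elim u v uv by (metis)
        then have "\<bar>birkhoff_sum f ?n (v (r j)) - birkhoff_sum f ?n (u (r j))\<bar> / real ?n \<le> e / 2"
          using n0[of "r j"] by (simp add: field_simps)
        then have "\<bar>birkhoff_sum f ?n (v (r j)) - birkhoff_sum f ?n (u (r j))\<bar> / real ?n < e"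
          using \<open>e > 0\<close> by linarith
        then show ?case
          using u v n0[of "r j"]
          by (simp add: integral_empirical f dist_real_def flip: diff_divide_distrib)
      qed
    qed
  qed
  ultimately have "(\<lambda>j. dist (U (?M (r j))) (U (?M' (r j)))) \<longlonglongrightarrow> dist (U L) (U L)"
    by (rule tendsto_dist)
  then have "\<epsilon> \<le> 0"
    using far by (intro LIMSEQ_le_const) auto
  with \<open>\<epsilon> > 0\<close> show False by simp
qed

text \<open>Strong connectivity gives every edge a successor, so a string extends forever by
  iterating a choice of successors. Suprema over cylinders are thereby taken over nonempty
  sets.\<close>

lemma cylinder_nonempty:
  assumes fin: "fin_digraph G" and sc: "strongly_connected G" and ne: "arcs G \<noteq> {}"
    and w: "w \<in> strings G n"
  shows "cylinder G w \<noteq> {}"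
proof -
  interpret fin_digraph G by fact
  \<comment> \<open>A loop succeeds itself; otherwise the first edge of a path from the head back to
    the tail will do.\<close>
  have ex: "\<exists>e'\<in>arcs G. tail G e' = head G e" if e: "e \<in> arcs G" for e
  proof (cases "head G e = tail G e")
    case False
    have "head G e \<rightarrow>\<^sup>*\<^bsub>G\<^esub> tail G e"
      using sc e by (auto simp: strongly_connected_def)
    then have "(head G e, tail G e) \<in> (arcs_ends G)\<^sup>*" by (rule reachable_rtranclI)
    with False obtain x where "(head G e, x) \<in> arcs_ends G"
      by (meson converse_rtranclE)
    then show ?thesis by (auto simp: arcs_ends_def arc_to_ends_def)
  qed (use e in auto)
  define nx where "nx e = (SOME e'. e' \<in> arcs G \<and> tail G e' = head G e)" for e
  have nx: "nx e \<in> arcs G" "tail G (nx e) = head G e" if "e \<in> arcs G" for e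
    using someI_ex[of "\<lambda>e'. e' \<in> arcs G \<and> tail G e' = head G e"] ex[OF that]
    by (auto simp: nx_def)
  obtain e0 where e0: "e0 \<in> arcs G" using ne by blast
  have iter: "(nx ^^ k) e \<in> arcs G" if "e \<in> arcs G" for k e
    using that by (induction k) (auto intro: nx)
  have len: "length w = n" and wa: "\<And>k. k < n \<Longrightarrow> w ! k \<in> arcs G"
    and ww: "\<And>k. Suc k < n \<Longrightarrow> head G (w ! k) = tail G (w ! Suc k)"
    using w by (auto simp: strings_def subset_iff)
  define s where "s = (if n = 0 then e0 else w ! (n - 1))"
  have s: "s \<in> arcs G" using e0 wa by (auto simp: s_def)
  \<comment> \<open>At \<open>k = n\<close> the exponent is 1, so the first new letter is a
    successor of \<open>s\<close>, the last letter of \<open>w\<close> or, if \<open>w\<close> is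
    empty, an arbitrary edge.\<close>
  define u where "u k = (if k < n then w ! k else (nx ^^ (Suc k - n)) s)" for k
  have "u k \<in> arcs G \<and> head G (u k) = tail G (u (Suc k))" for k
  proof -
    consider "Suc k < n" | "Suc k = n" | "k \<ge> n" by linarith
    then show ?thesis
    proof cases
      case 1
      then show ?thesis using wa ww by (simp add: u_def)
    next
      case 2
      then have "u k = s" "u (Suc k) = nx s" by (auto simp: u_def s_def)
      then show ?thesis using nx s by simp
    next
      case 3
      then have "u (Suc k) = nx (u k)" "u k \<in> arcs G"
        using iter[OF s, of "Suc k - n"] by (auto simp: u_def Suc_diff_le)
      then show ?thesis using nx by simp
    qed
  qed
  then have "u \<in> cylinder G w" by (simp add: cylinder_def inf_strings_def len) (simp add: u_def)
  then show ?thesis by blast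
qed

section \<open>The fine zeta-function\<close>

text \<open>The slack \<open>(c - t) * L\<close> gained from \<open>t \<le> c\<close> is split into two halves. One
  absorbs the distortion \<open>D\<close>, which only matters when \<open>c < 0\<close> and the supremum on the
  left is attained where \<open>S\<close> is smallest.\<close>

lemma sup_exp_bound:
  fixes S :: "'a \<Rightarrow> real"
  assumes A: "A \<noteq> {}" and L: "\<And>u. u \<in> A \<Longrightarrow> S u \<le> - L" "L \<ge> 0"
    and D: "\<And>u v. u \<in> A \<Longrightarrow> v \<in> A \<Longrightarrow> \<bar>S u - S v\<bar> \<le> D"
    and xt: "x \<le> t" "t \<le> c" and cD: "\<bar>c\<bar> * D \<le> (c - t) * L / 2"
  shows "\<bar>SUP u\<in>A. exp (c * S u)\<bar> \<le> exp (x * (SUP u\<in>A. S u)) * exp (- ((c - t) * L / 2))"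
proof -
  let ?\<sigma> = "SUP u\<in>A. S u"
  have \<sigma>L: "?\<sigma> \<le> - L" using A L by (intro cSUP_least)
  have up: "S u \<le> ?\<sigma>" if "u \<in> A" for u
    using that L by (intro cSUP_upper) (auto intro!: bdd_aboveI2)
  have lo: "?\<sigma> \<le> S u + D" if "u \<in> A" for u
    using A
  proof (rule cSUP_least)
    show "S v \<le> S u + D" if "v \<in> A" for v using D[OF that \<open>u \<in> A\<close>] by simp
  qed
  have bd: "exp (c * S u) \<le> exp (x * ?\<sigma>) * exp (- ((c - t) * L / 2))" if u: "u \<in> A" for u
  proof -
    have "c * (S u - ?\<sigma>) \<le> \<bar>c\<bar> * \<bar>S u - ?\<sigma>\<bar>" by (metis abs_ge_self abs_mult)
    also have "\<dots> \<le> \<bar>c\<bar> * D" using up[OF u] lo[OF u] by (intro mult_left_mono) auto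
    finally have 1: "c * S u \<le> c * ?\<sigma> + \<bar>c\<bar> * D" by (simp add: algebra_simps)
    have 2: "c * ?\<sigma> \<le> t * ?\<sigma> - (c - t) * L"
      using mult_left_mono[OF \<sigma>L, of "c - t"] xt by (simp add: algebra_simps)
    \<comment> \<open>\<open>?\<sigma>\<close> is at most \<open>- L\<close> and so nonpositive;
      lowering the coefficient from \<open>t\<close> to \<open>x\<close> can only increase the
      product.\<close>
    have 3: "t * ?\<sigma> \<le> x * ?\<sigma>" using \<sigma>L L(2) xt by (intro mult_right_mono_neg) auto
    have combine: "a \<le> f + (- (l / 2))" if "a \<le> b + d" "b \<le> e - l" "e \<le> f" "d \<le> l / 2"
      for a b d e f l :: real
      using that by simp
    have "c * S u \<le> x * ?\<sigma> + (- ((c - t) * L / 2))"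
      by (rule combine[OF 1 2 3 cD])
    then show ?thesis by (simp flip: exp_add)
  qed
  obtain u where u: "u \<in> A" using A by blast
  have "0 \<le> exp (c * S u)" by simp
  also have "\<dots> \<le> (SUP u\<in>A. exp (c * S u))"
    using u bd by (intro cSUP_upper) (auto intro!: bdd_aboveI2)
  finally have "0 \<le> (SUP u\<in>A. exp (c * S u))" .
  moreover have "(SUP u\<in>A. exp (c * S u)) \<le> exp (x * ?\<sigma>) * exp (- ((c - t) * L / 2))"
    using A bd by (intro cSUP_least)
  ultimately show ?thesis by simp
qed

text \<open>On the compact set \<open>K - V\<close>, which misses the closure of \<open>C\<close>,
  the distance to \<open>C\<close> attains a positive minimum; this minimum is the radius.\<close>

lemma compact_nbhd_subset:
  fixes K :: "'x::metric_space set"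
  assumes K: "compact K" and V: "open V" and sub: "K \<inter> closure C \<subseteq> V"
  obtains r where "r > 0" "\<And>\<rho>. \<rho> < r \<Longrightarrow> K \<inter> nbhd C \<rho> \<subseteq> V"
proof (cases "C = {} \<or> K - V = {}")
  case True
  then show thesis using that[of 1] by (auto simp: nbhd_def)
next
  case False
  have "compact (K - V)" using K V by (rule compact_diff)
  moreover have "continuous_on (K - V) (\<lambda>x. infdist x C)" by (intro continuous_intros)
  ultimately obtain x where x: "x \<in> K - V" "\<forall>y\<in>K - V. infdist x C \<le> infdist y C"
    using continuous_attains_inf False by blast
  have "infdist x C \<noteq> 0"
    using x(1) sub False in_closure_iff_infdist_zero[of C x] by auto
  then have "infdist x C > 0" using infdist_nonneg[of x C] by linarith
  then show thesis
    by (rule that) (use x(2) in \<open>force simp: nbhd_def\<close>)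
qed

section \<open>The coarse zeta-function at real arguments and the Legendre transform\<close>

lemma summable_coarse_term:
  assumes "tau G U \<phi> q < ereal s"
  shows "summable (\<lambda>n. coarse_term G U \<phi> q (of_real s) (Suc n))"
  using assms unfolding tau_def conv_abscissa_def Inf_less_iff by auto

text \<open>At a real argument all summands are positive reals, so a bound on the modulus of the
  term bounds the sum of the weights without cancellation.\<close>

lemma coarse_term_of_real:
  "coarse_term G U \<phi> q (of_real s) n =
     of_real (\<Sum>w\<in>strings G n. exp (((SUP u\<in>cylinder G w. inner q (U (empirical G n u))) + s) *
                (SUP u\<in>cylinder G w. birkhoff_sum \<phi> n u)))"
  by (simp add: coarse_term_def exp_of_real flip: of_real_add of_real_mult)

text \<open>Supplies a real \<open>s\<close> strictly above \<open>g y\<close>, also when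
  \<open>g y\<close> is minus infinity. For \<open>g = tau G U \<phi>\<close> the coarse series
  converges at this \<open>s\<close>.\<close>

lemma legendre_lessD:
  assumes "legendre g x < ereal t"
  obtains y s where "g y < ereal s" "inner x y + s < t"
proof -
  obtain y where y: "ereal (inner x y) + g y < ereal t"
    using assms by (auto simp: legendre_def INF_less_iff)
  then have "g y < ereal (t - inner x y)" by (cases "g y") auto
  then obtain s where "g y < ereal s" "ereal s < ereal (t - inner x y)"
    using ereal_dense2 by blast
  then show thesis using that[of y s] by simp
qed

lemma birkhoff_sum_cmult: "birkhoff_sum (\<lambda>u. c * \<phi> u) n u = c * birkhoff_sum \<phi> n u"
  by (simp add: birkhoff_sum_def sum_distrib_left)

lemma potential_bounded_away:
  assumes fin: "finite (arcs G)" and \<phi>: "continuous_map (shift_topology G) euclideanreal \<phi>"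
    and neg: "\<forall>u\<in>inf_strings G. \<phi> u < 0"
  obtains m where "m > 0" "\<And>u. u \<in> inf_strings G \<Longrightarrow> \<phi> u \<le> - m"
proof (cases "inf_strings G = {}")
  case False
  have "compact (\<phi> ` inf_strings G)"
    using image_compactin[OF _ \<phi>, of "topspace (shift_topology G)"] compact_shift_topology[OF fin]
    by (simp add: compact_space_def)
  then obtain u where "u \<in> inf_strings G" "\<And>v. v \<in> inf_strings G \<Longrightarrow> \<phi> v \<le> \<phi> u"
    using compact_attains_sup[of "\<phi> ` inf_strings G"] False by auto
  then show thesis using that[of "- \<phi> u"] neg by auto
qed (use that[of 1] in auto)

lemma fps_conv_radius_geI_exp_decay:
  fixes f :: "complex fps"
  assumes "\<And>n. n \<ge> N \<Longrightarrow> norm (fps_nth f n) \<le> exp (- (real n * \<delta>)) * B" and "\<delta> > 0"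
  shows "ereal (exp (\<delta> / 2)) \<le> fps_conv_radius f"
proof -
  \<comment> \<open>Half of the decay rate is spent on the powers of \<open>?z\<close>; the other
    half leaves a geometric series.\<close>
  let ?z = "of_real (exp (\<delta> / 2)) :: complex"
  have "summable (\<lambda>n. fps_nth f n * ?z ^ n)"
  proof (rule summable_comparison_test')
    show "summable (\<lambda>n. B * exp (- \<delta> / 2) ^ n)"
      using \<open>\<delta> > 0\<close> by (intro summable_mult summable_geometric) simp
    show "norm (fps_nth f n * ?z ^ n) \<le> B * exp (- \<delta> / 2) ^ n" if "n \<ge> N" for n
    proof -
      have "norm (fps_nth f n * ?z ^ n) \<le> exp (- (real n * \<delta>)) * B * exp (\<delta> / 2) ^ n"
        using assms(1)[OF that] by (simp add: norm_mult norm_power mult_right_mono)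
      also have "\<dots> = B * (exp (- (real n * \<delta>)) * exp (real n * (\<delta> / 2)))"
        unfolding exp_of_nat_mult[of n "\<delta> / 2"] by (simp only: mult_ac)
      also have "\<dots> = B * exp (real n * (- \<delta> / 2))"
        by (simp flip: exp_add)
      finally show ?thesis by (simp only: exp_of_nat_mult)
    qed
  qed
  from conv_radius_geI[OF this] show ?thesis by (simp add: fps_conv_radius_def)
qed

text \<open>Every string counted by the fine zeta-function is compared, through
  \<open>sup_exp_bound\<close>, with its summand in one of finitely many coarse terms, indexed by
  \<open>F\<close>. Summing over all of \<open>F\<close> and all strings only adds positive
  quantities.\<close>

lemma fine_zeta_coefficient_bound:
  fixes U :: "(nat \<Rightarrow> 'e) measure \<Rightarrow> 'x::real_inner"
  assumes n: "n > 0" and fin: "finite (arcs G)" "finite F"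
    and cyl: "\<And>w. w \<in> strings G n \<Longrightarrow> cylinder G w \<noteq> {}"
    and m: "m > 0" "\<And>u. u \<in> inf_strings G \<Longrightarrow> \<phi> u \<le> - m"
    and tc: "t \<le> c" and \<eta>: "\<bar>c\<bar> * \<eta> \<le> (c - t) * m / 2"
    and dist: "\<And>u v. u \<in> inf_strings G \<Longrightarrow> v \<in> inf_strings G \<Longrightarrow> \<forall>k<n. u k = v k \<Longrightarrow>
           \<bar>birkhoff_sum \<phi> n u - birkhoff_sum \<phi> n v\<bar> \<le> real n * \<eta>"
    and cover: "\<And>w. w \<in> strings G n \<Longrightarrow> (\<lambda>u. U (empirical G n u)) ` cylinder G w \<subseteq> C \<Longrightarrow>
           \<exists>\<alpha>\<in>F. (SUP u\<in>cylinder G w. inner (q \<alpha>) (U (empirical G n u))) + s \<alpha> \<le> t"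
    and B: "\<And>\<alpha>. \<alpha> \<in> F \<Longrightarrow> norm (coarse_term G U \<phi> (q \<alpha>) (of_real (s \<alpha>)) n) \<le> B \<alpha>"
  shows "norm (fps_nth (fine_zeta G U C (\<lambda>u. c * \<phi> u)) n)
           \<le> exp (- (real n * ((c - t) * m / 2))) * (\<Sum>\<alpha>\<in>F. B \<alpha>)"
proof -
  let ?P = "\<lambda>w. (\<lambda>u. U (empirical G n u)) ` cylinder G w \<subseteq> C"
  let ?E = "exp (- (real n * ((c - t) * m / 2)))"
  define y where "y \<alpha> w = exp (((SUP u\<in>cylinder G w. inner (q \<alpha>) (U (empirical G n u))) + s \<alpha>) *
                (SUP u\<in>cylinder G w. birkhoff_sum \<phi> n u))" for \<alpha> w
  define Z where "Z w = (SUP u\<in>cylinder G w. exp (birkhoff_sum (\<lambda>u. c * \<phi> u) n u))" for w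
  have fs: "finite (strings G n)" by (rule finite_strings[OF fin(1)])
  have Z: "\<bar>Z w\<bar> \<le> (\<Sum>\<alpha>\<in>F. y \<alpha> w) * ?E" if w: "w \<in> strings G n" "?P w" for w
  proof -
    obtain \<alpha> where \<alpha>: "\<alpha> \<in> F" "(SUP u\<in>cylinder G w. inner (q \<alpha>) (U (empirical G n u))) + s \<alpha> \<le> t"
      using cover[OF w] by blast
    have len: "length w = n" using w(1) by (simp add: strings_def)
    have "\<bar>SUP u\<in>cylinder G w. exp (c * birkhoff_sum \<phi> n u)\<bar> \<le> y \<alpha> w * exp (- ((c - t) * (real n * m) / 2))"
      unfolding y_def
    \<comment> \<open>Here \<open>L\<close> is \<open>real n * m\<close> and \<open>D\<close> is
      \<open>real n * \<eta>\<close>, both linear in \<open>n\<close>.\<close>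
    proof (rule sup_exp_bound[OF cyl[OF w(1)] _ _ _ \<alpha>(2) tc])
      fix u assume u: "u \<in> cylinder G w"
      have "birkhoff_sum \<phi> n u \<le> (\<Sum>k<n. - m)"
        unfolding birkhoff_sum_def
        using u by (intro sum_mono m inf_strings_shift) (auto simp: cylinder_def)
      then show "birkhoff_sum \<phi> n u \<le> - (real n * m)" by simp
      show "\<bar>birkhoff_sum \<phi> n u - birkhoff_sum \<phi> n v\<bar> \<le> real n * \<eta>" if "v \<in> cylinder G w" for v
        using u that len by (intro dist) (auto simp: cylinder_def)
    next
      show "\<bar>c\<bar> * (real n * \<eta>) \<le> (c - t) * (real n * m) / 2"
        using mult_left_mono[OF \<eta>, of "real n"] by (simp add: mult_ac)
    qed (use m in auto)
    also have "\<dots> = y \<alpha> w * ?E" by (simp add: mult_ac)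
    \<comment> \<open>The index \<open>\<alpha>\<close> depends on \<open>w\<close>; the sum over
      \<open>F\<close> removes this dependence.\<close>
    also have "\<dots> \<le> (\<Sum>\<alpha>\<in>F. y \<alpha> w) * ?E"
      using \<alpha>(1) fin(2) by (intro mult_right_mono member_le_sum) (auto simp: y_def)
    finally show ?thesis by (simp add: Z_def birkhoff_sum_cmult)
  qed
  have "norm (fps_nth (fine_zeta G U C (\<lambda>u. c * \<phi> u)) n) = \<bar>\<Sum>w | w \<in> strings G n \<and> ?P w. Z w\<bar> / real n"
    using n by (simp add: fine_zeta_def Z_def norm_divide flip: of_real_divide of_real_sum)
  also have "\<dots> \<le> \<bar>\<Sum>w | w \<in> strings G n \<and> ?P w. Z w\<bar>"
    using n mult_left_mono[of 1 "real n" "\<bar>\<Sum>w | w \<in> strings G n \<and> ?P w. Z w\<bar>"]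
    by (simp add: divide_le_eq)
  also have "\<dots> \<le> (\<Sum>w | w \<in> strings G n \<and> ?P w. \<bar>Z w\<bar>)" by (rule sum_abs)
  also have "\<dots> \<le> (\<Sum>w | w \<in> strings G n \<and> ?P w. (\<Sum>\<alpha>\<in>F. y \<alpha> w) * ?E)"
    using Z by (intro sum_mono) auto
  also have "\<dots> \<le> (\<Sum>w\<in>strings G n. (\<Sum>\<alpha>\<in>F. y \<alpha> w) * ?E)"
    using fs by (intro sum_mono2) (auto simp: y_def intro!: mult_nonneg_nonneg sum_nonneg)
  also have "\<dots> = ?E * (\<Sum>\<alpha>\<in>F. \<Sum>w\<in>strings G n. y \<alpha> w)"
    by (subst sum.swap) (simp only: sum_distrib_right mult.commute[of ?E])
  also have "\<dots> \<le> ?E * (\<Sum>\<alpha>\<in>F. B \<alpha>)"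
  proof (intro mult_left_mono sum_mono)
    fix \<alpha> assume "\<alpha> \<in> F"
    then have "norm (of_real (\<Sum>w\<in>strings G n. y \<alpha> w) :: complex) \<le> B \<alpha>"
      using B by (simp only: coarse_term_of_real y_def)
    then show "(\<Sum>w\<in>strings G n. y \<alpha> w) \<le> B \<alpha>" by (simp only: norm_of_real)
  qed simp
  finally show ?thesis .
qed

section \<open>The covering argument and the bound on the radius of convergence\<close>

theorem theorem4p3:
  fixes G :: "('v, 'e) pre_digraph"
    and U :: "(nat \<Rightarrow> 'e) measure \<Rightarrow> 'x::real_inner"
    and \<phi> :: "(nat \<Rightarrow> 'e) \<Rightarrow> real"
    and C :: "'x set"
    and fC :: real
  assumes "fin_digraph G" and "strongly_connected G" and "arcs G \<noteq> {}"
    and "continuous_map (weak_topology (shift_topology G)) euclidean U"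
    and "continuous_map (shift_topology G) euclideanreal \<phi>"
    and "\<forall>u\<in>inf_strings G. \<phi> u < 0"
    and "Limsup (at_right 0)
           (\<lambda>r. fps_conv_radius (fine_zeta G U (nbhd C r) (\<lambda>u. fC * \<phi> u))) = 1"
  shows "ereal fC \<le> (SUP \<alpha>\<in>closure C. legendre (tau G U \<phi>) \<alpha>)"
proof (rule ccontr)
  let ?T = "shift_topology G"
  interpret fin_digraph G by fact
  note fin = finite_arcs
  assume "\<not> ?thesis"
  then have "(SUP \<alpha>\<in>closure C. legendre (tau G U \<phi>) \<alpha>) < ereal fC" by simp
  then obtain t where t: "(SUP \<alpha>\<in>closure C. legendre (tau G U \<phi>) \<alpha>) < ereal t" "t < fC"
    using ereal_dense2 by force
  \<comment> \<open>The gap from \<open>t\<close> to \<open>t'\<close> absorbs the oscillation of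
    \<open>U\<close> on cylinders; the gap from \<open>t'\<close> to \<open>fC\<close> yields the
    exponential decay.\<close>
  define t' where "t' = (t + fC) / 2"
  have t': "t < t'" "t' < fC" using t by (auto simp: t'_def)
  obtain h where h: "real_embedded_compact ?T h"
    by (rule shift_space_embedding[OF fin]) (rule that)
  define K where "K = U ` borel_probs ?T"
  have K: "compact K"
    unfolding K_def by (rule real_embedded_compact.compact_weak_continuous_image[OF h assms(4)])
  have "\<exists>q s. tau G U \<phi> q < ereal s \<and> inner \<alpha> q + s < t" if "\<alpha> \<in> K \<inter> closure C" for \<alpha>
  proof -
    have "legendre (tau G U \<phi>) \<alpha> < ereal t"
      using t(1) that by (auto simp: less_SUP_iff intro: le_less_trans[OF SUP_upper])
    then show ?thesis by (metis legendre_lessD)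
  qed
  then obtain q s where qs: "\<And>\<alpha>. \<alpha> \<in> K \<inter> closure C \<Longrightarrow> tau G U \<phi> (q \<alpha>) < ereal (s \<alpha>)"
     "\<And>\<alpha>. \<alpha> \<in> K \<inter> closure C \<Longrightarrow> inner \<alpha> (q \<alpha>) + s \<alpha> < t"
    by metis
  define O' where "O' \<alpha> = {x. inner x (q \<alpha>) + s \<alpha> < t}" for \<alpha>
  have O': "open (O' \<alpha>)" for \<alpha>
    unfolding O'_def by (intro open_Collect_less continuous_intros)
  obtain F where F: "F \<subseteq> K \<inter> closure C" "finite F" "K \<inter> closure C \<subseteq> (\<Union>\<alpha>\<in>F. O' \<alpha>)"
  proof (rule compactE_image[of "K \<inter> closure C" "K \<inter> closure C" O'])
    show "compact (K \<inter> closure C)" using K by (intro compact_Int_closed) auto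
    show "K \<inter> closure C \<subseteq> (\<Union>\<alpha>\<in>K \<inter> closure C. O' \<alpha>)" using qs(2) by (auto simp: O'_def)
  qed (use O' in auto)
  obtain r0 where r0: "r0 > 0" "\<And>r. r < r0 \<Longrightarrow> K \<inter> nbhd C r \<subseteq> (\<Union>\<alpha>\<in>F. O' \<alpha>)"
    by (rule compact_nbhd_subset[OF K _ F(3)]) (use O' in auto)
  have "\<exists>B. \<forall>k. norm (coarse_term G U \<phi> (q \<alpha>) (of_real (s \<alpha>)) (Suc k)) \<le> B" if "\<alpha> \<in> F" for \<alpha>
  proof -
    have "summable (\<lambda>k. coarse_term G U \<phi> (q \<alpha>) (of_real (s \<alpha>)) (Suc k))"
      using that F(1) qs(1) by (intro summable_coarse_term) auto
    then have "Bseq (\<lambda>k. coarse_term G U \<phi> (q \<alpha>) (of_real (s \<alpha>)) (Suc k))"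
      by (intro convergent_imp_Bseq convergentI[OF summable_LIMSEQ_zero])
    then show ?thesis by (auto simp: Bseq_def)
  qed
  then obtain B where B: "\<And>\<alpha> k. \<alpha> \<in> F \<Longrightarrow>
      norm (coarse_term G U \<phi> (q \<alpha>) (of_real (s \<alpha>)) (Suc k)) \<le> B \<alpha>"
    by metis
  obtain m where m: "m > 0" "\<And>u. u \<in> inf_strings G \<Longrightarrow> \<phi> u \<le> - m"
    by (rule potential_bounded_away[OF fin assms(5,6)]) (rule that, simp_all)
  \<comment> \<open>The decay rate left after \<open>sup_exp_bound\<close> has spent the other half
    of the slack on distortion.\<close>
  define \<delta> where "\<delta> = (fC - t') * m / 2"
  have \<delta>: "\<delta> > 0" using t' m by (simp add: \<delta>_def)
  \<comment> \<open>Adding 1 avoids division by zero when \<open>fC = 0\<close>.\<close>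
  define \<eta> where "\<eta> = \<delta> / (\<bar>fC\<bar> + 1)"
  have \<eta>: "\<eta> > 0" "\<bar>fC\<bar> * \<eta> \<le> \<delta>"
    using \<delta> by (auto simp: \<eta>_def field_simps)
  \<comment> \<open>Chosen so that moving by \<open>\<epsilon>\<close> changes none of the inner
    products with the finitely many \<open>q \<alpha>\<close> by more than
    \<open>t' - t\<close>.\<close>
  define \<epsilon> where "\<epsilon> = (t' - t) / (1 + (\<Sum>\<alpha>\<in>F. norm (q \<alpha>)))"
  have sq: "0 \<le> (\<Sum>\<alpha>\<in>F. norm (q \<alpha>))" by (simp add: sum_nonneg)
  then have \<epsilon>: "\<epsilon> > 0" using t' by (simp add: \<epsilon>_def)
  have q\<epsilon>: "norm (q \<alpha>) * \<epsilon> \<le> t' - t" if "\<alpha> \<in> F" for \<alpha>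
  proof -
    have "norm (q \<alpha>) \<le> 1 + (\<Sum>\<alpha>\<in>F. norm (q \<alpha>))"
      using member_le_sum[OF that, of "\<lambda>\<alpha>. norm (q \<alpha>)"] F(2) by simp
    then show ?thesis
      using t' sq by (simp add: \<epsilon>_def divide_le_eq mult.commute mult_left_mono)
  qed
  have "\<forall>\<^sub>F n in sequentially. n > 0 \<and>
      (\<forall>u\<in>inf_strings G. \<forall>v\<in>inf_strings G. (\<forall>k<n. u k = v k) \<longrightarrow>
           \<bar>birkhoff_sum \<phi> n u - birkhoff_sum \<phi> n v\<bar> \<le> real n * \<eta>) \<and>
      (\<forall>u\<in>inf_strings G. \<forall>v\<in>inf_strings G. (\<forall>k<n. u k = v k) \<longrightarrow>
           dist (U (empirical G n u)) (U (empirical G n v)) < \<epsilon>)"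
    by (intro eventually_conj eventually_gt_at_top birkhoff_distortion[OF fin assms(5) \<eta>(1)]
          cylinder_oscillation[OF fin assms(4) \<epsilon>])
  then obtain N where N: "\<And>n. n \<ge> N \<Longrightarrow> n > 0"
    "\<And>n u v. n \<ge> N \<Longrightarrow> u \<in> inf_strings G \<Longrightarrow> v \<in> inf_strings G \<Longrightarrow> \<forall>k<n. u k = v k \<Longrightarrow>
           \<bar>birkhoff_sum \<phi> n u - birkhoff_sum \<phi> n v\<bar> \<le> real n * \<eta>"
    "\<And>n u v. n \<ge> N \<Longrightarrow> u \<in> inf_strings G \<Longrightarrow> v \<in> inf_strings G \<Longrightarrow> \<forall>k<n. u k = v k \<Longrightarrow>
           dist (U (empirical G n u)) (U (empirical G n v)) < \<epsilon>"
    unfolding eventually_sequentially by (metis (no_types, lifting))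
  \<comment> \<open>The index \<open>\<alpha>\<close> is chosen at a single point \<open>v\<close>
    of the cylinder; small oscillation of \<open>U\<close> extends the estimate to all of it, with
    \<open>t'\<close> in place of \<open>t\<close>.\<close>
  have cover: "\<exists>\<alpha>\<in>F. (SUP u\<in>cylinder G w. inner (q \<alpha>) (U (empirical G n u))) + s \<alpha> \<le> t'"
    if n: "n \<ge> N" and r: "r < r0" and w: "w \<in> strings G n"
      and sub: "(\<lambda>u. U (empirical G n u)) ` cylinder G w \<subseteq> nbhd C r" for n r w
  proof -
    have ne: "cylinder G w \<noteq> {}" by (rule cylinder_nonempty[OF assms(1-3) w])
    have len: "length w = n" using w by (simp add: strings_def)
    obtain v where v: "v \<in> cylinder G w" using ne by blast
    then have vG: "v \<in> inf_strings G" by (simp add: cylinder_def)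
    have "U (empirical G n v) \<in> K"
      unfolding K_def using empirical_borel_probs[OF N(1)[OF n] vG] by blast
    moreover have "U (empirical G n v) \<in> nbhd C r" using sub v by blast
    ultimately obtain \<alpha> where \<alpha>: "\<alpha> \<in> F" "inner (U (empirical G n v)) (q \<alpha>) + s \<alpha> < t"
      using r0(2)[OF r] by (auto simp: O'_def)
    have "(SUP u\<in>cylinder G w. inner (q \<alpha>) (U (empirical G n u))) \<le> t' - s \<alpha>"
    proof (rule cSUP_least[OF ne])
      fix u assume u: "u \<in> cylinder G w"
      have d: "dist (U (empirical G n u)) (U (empirical G n v)) < \<epsilon>"
        using u v len by (intro N(3)[OF n]) (auto simp: cylinder_def)
      have "inner (q \<alpha>) (U (empirical G n u) - U (empirical G n v)) \<le> norm (q \<alpha>) * \<epsilon>"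
        using norm_cauchy_schwarz d mult_left_mono[OF less_imp_le[OF d], of "norm (q \<alpha>)"]
        by (metis dist_norm norm_ge_zero order_trans)
      then show "inner (q \<alpha>) (U (empirical G n u)) \<le> t' - s \<alpha>"
        using q\<epsilon>[OF \<alpha>(1)] \<alpha>(2) by (simp add: inner_diff_right inner_commute)
    qed
    with \<alpha>(1) show ?thesis by (auto simp: algebra_simps)
  qed
  \<comment> \<open>\<open>N\<close>, \<open>B\<close> and \<open>\<delta>\<close> do not depend on
    \<open>r\<close>, so the bound is uniform for \<open>r < r0\<close>.\<close>
  have radius: "ereal (exp (\<delta> / 2)) \<le> fps_conv_radius (fine_zeta G U (nbhd C r) (\<lambda>u. fC * \<phi> u))"
    if r: "r < r0" for r
  proof (rule fps_conv_radius_geI_exp_decay[OF _ \<delta>])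
    fix n assume n: "n \<ge> N"
    show "norm (fps_nth (fine_zeta G U (nbhd C r) (\<lambda>u. fC * \<phi> u)) n)
            \<le> exp (- (real n * \<delta>)) * (\<Sum>\<alpha>\<in>F. B \<alpha>)"
      unfolding \<delta>_def
    proof (rule fine_zeta_coefficient_bound[where \<eta> = \<eta> and q = q and s = s])
      show "norm (coarse_term G U \<phi> (q \<alpha>) (of_real (s \<alpha>)) n) \<le> B \<alpha>" if "\<alpha> \<in> F" for \<alpha>
        \<comment> \<open>\<open>B\<close> bounds the terms indexed by \<open>Suc k\<close>, hence
          the shift by one.\<close>
        using B[OF that, of "n - 1"] N(1)[OF n] by simp
      show "cylinder G w \<noteq> {}" if "w \<in> strings G n" for w
        by (rule cylinder_nonempty[OF assms(1-3) that])
      show "\<bar>fC\<bar> * \<eta> \<le> (fC - t') * m / 2" using \<eta>(2) by (simp add: \<delta>_def)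
    qed (use N[OF n] fin F(2) m t' cover[OF n r] in auto)
  qed
  have "\<forall>\<^sub>F r in at_right 0. ereal (exp (\<delta> / 2)) \<le>
          fps_conv_radius (fine_zeta G U (nbhd C r) (\<lambda>u. fC * \<phi> u))"
    unfolding eventually_at_right_field using r0(1) radius by blast
  \<comment> \<open>The limsup is at least \<open>exp (\<delta> / 2)\<close>, which exceeds
    1.\<close>
  then have "ereal (exp (\<delta> / 2)) \<le> Limsup (at_right 0)
           (\<lambda>r. fps_conv_radius (fine_zeta G U (nbhd C r) (\<lambda>u. fC * \<phi> u)))"
    by (intro le_Limsup) auto
  then show False using \<delta> assms(7) by simp
qed

end
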